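(* For integers $k\ge 0$ and $m\ge 1$ the following identity holds: $$\zeta\left(\overline{k+2},\{1\}_{m-1}\right)=\frac{(-1)^{m+k}}{m!\,k!}\,I(k,m),$$ where $I(k,m)$ is defined by the integral $$I(k,m):=\int_0^1 \frac{(\ln x)^k\,\ln^m(1+x)}{x}\,dx .$$ Moreover, $$\begin{aligned} I(k,m)=&\ \frac{1}{m+k+1}(\ln 2)^{m+k+1}+(m+k)!\,\zeta(m+k+1)-\sum_{l=0}^{m+k} l!\binom{m+k}{l}(\ln 2)^{m+k-l}\,\mathrm{Li}_{l+1}\left(\tfrac12\right)\\ &+(-1)^k\sum_{j=1}^{k} j!\,(k+m-j)!\binom{k}{j}\Big\{\zeta\left(k+m+2-j,\{1\}_{j-1}\right)+\zeta\left(k+m+1-j,\{1\}_{j}\right)\Big\}\\ &-(-1)^k\sum_{j=1}^{k}\sum_{l=0}^{k+m-j} j!\,l!\binom{k}{j}\binom{k+m-j}{l}(\ln 2)^{m+k-j-l}\Big\{\zeta\left(l+2,\{1\}_{j-1};\tfrac12\right)+\zeta\left(l+1,\{1\}_{j};\tfrac12\right)\Big\}. \end{aligned}$$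
   Context: Notation. $\{1\}_r$ denotes the string of $r$ entries equal to $1$ (empty if $r=0$). For positive integers $s_1,\dots,s_r$ with $s_1\ge 2$, $\zeta(s_1,\dots,s_r):=\sum_{k_1>\cdots>k_r\ge1}\frac{1}{k_1^{s_1}\cdots k_r^{s_r}}$. A bar over an entry $s_j$ means that the factor $(-1)^{k_j}$ is inserted in the summand; e.g. $\zeta(\overline{k+2},\{1\}_{m-1})=\sum_{k_1>\cdots>k_m\ge1}\frac{(-1)^{k_1}}{k_1^{k+2}k_2\cdots k_m}$. For $x\in[-1,1)$, $\zeta(s_1,\dots,s_r;x):=\sum_{k_1>\cdots>k_r\ge1}\frac{x^{k_1}}{k_1^{s_1}\cdots k_r^{s_r}}$, and $\mathrm{Li}_p(x):=\sum_{n\ge1}x^n/n^p$. Sums over empty ranges are $0$.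
   Formalization: In the formula for I(k,m), the factor (-1)^k in front of the two sums over j is replaced by (-1)^j inside them; the printed formula is false for every k ≥ 2 (e.g. k=2, m=1) and agrees with the corrected one for k ≤ 1. *)

theory Defs
  imports "HOL-Analysis.Analysis"
begin

text \<open>
  The tuples \<open>k\<^sub>1 > \<dots> > k\<^sub>r \<ge> 1\<close> with prescribed leading entry \<open>k\<^sub>1 = n\<close>, for \<open>r \<ge> 1\<close>
  (entry \<open>k\<^sub>j\<close> is \<open>ks ! (j - 1)\<close>).  For each \<open>n\<close> there are finitely many, and none for \<open>n = 0\<close>.
\<close>

definition decreasing_tuples :: "nat \<Rightarrow> nat \<Rightarrow> nat list set" where
  "decreasing_tuples r n =
     {ks. length ks = r \<and> sorted_wrt (>) ks \<and> (\<forall>i\<in>set ks. i \<ge> 1) \<and> hd ks = n}"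

text \<open>
  \<open>\<Sum> c(k\<^sub>1,\<dots>,k\<^sub>r) / (k\<^sub>1^s\<^sub>1 \<cdots> k\<^sub>r^s\<^sub>r)\<close> over all \<open>k\<^sub>1 > \<dots> > k\<^sub>r \<ge> 1\<close>, for a nonempty list of
  exponents. The outermost index \<open>k\<^sub>1\<close> is summed in increasing order, which matters only where
  convergence is conditional (\<open>s\<^sub>1 = 1\<close> and \<open>x = -1\<close> below).
\<close>

definition nested_series :: "(nat list \<Rightarrow> real) \<Rightarrow> nat list \<Rightarrow> real" where
  "nested_series c ss =
     (\<Sum>n. \<Sum>ks\<in>decreasing_tuples (length ss) n.
        c ks / (\<Prod>j<length ss. real (ks ! j) ^ (ss ! j)))"

definition mzeta :: "nat list \<Rightarrow> real" where
  "mzeta ss = nested_series (\<lambda>ks. 1) ss"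

text \<open>\<open>B\<close> is the set of (zero-based) positions of the barred entries.\<close>

definition mzeta_bar :: "nat set \<Rightarrow> nat list \<Rightarrow> real" where
  "mzeta_bar B ss = nested_series (\<lambda>ks. \<Prod>j\<in>B. (-1) ^ (ks ! j)) ss"

definition mzeta_at :: "nat list \<Rightarrow> real \<Rightarrow> real" where
  "mzeta_at ss x = nested_series (\<lambda>ks. x ^ hd ks) ss"

definition Li :: "nat \<Rightarrow> real \<Rightarrow> real" where
  "Li p x = (\<Sum>n. x ^ Suc n / real (Suc n) ^ p)"

text \<open>
  The integrand's value at \<open>0\<close> is irrelevant.  In the evaluation of this integral the sign \<open>(-1)^j\<close>
  belongs inside the sums over \<open>j\<close>: it comes from the substitution \<open>x = (1 - u) / u\<close> and
  \<open>ln(1 - u)^j = (-1)^j j! \<zeta>(1,\<dots>,1; u)\<close> (with \<open>j\<close> ones).  The version with a common factor \<open>(-1)^k\<close>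
  in front of these sums, found in the literature, agrees for \<open>k \<le> 1\<close> but fails
  numerically, e.g. for \<open>k = 2\<close>, \<open>m = 1\<close>.
\<close>

definition log_integral :: "nat \<Rightarrow> nat \<Rightarrow> real" where
  "log_integral k m = integral {0..1} (\<lambda>x::real. ln x ^ k * ln (1 + x) ^ m / x)"

end

theory Submission
  imports Defs "HOL-Real_Asymp.Real_Asymp"
begin

text \<open>
  The generating functions of the nested harmonic sums \<open>h\<^sub>j(n) = \<Sum>1/(k\<^sub>1\<cdots>k\<^sub>j)\<close> over
  \<open>n \<ge> k\<^sub>1 > \<dots> > k\<^sub>j \<ge> 1\<close> are \<open>\<Sum> h\<^sub>j(n) u\<^sup>n = (-ln(1-u))\<^sup>j / (j! (1-u))\<close> and its primitive.
  Expanding \<open>ln(1+x)\<^sup>m / x\<close> and integrating termwise against \<open>(ln x)\<^sup>k\<close> gives the alternating sum.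
  For the evaluation, substitute \<open>u = 1/(1+x)\<close>: then \<open>ln(1+x) = -ln u\<close>, \<open>ln x = ln(1-u) - ln u\<close> and
  \<open>dx/x\<close> becomes \<open>(1/u + 1/(1-u)) du\<close> on \<open>(1/2, 1)\<close>.  After a binomial expansion each piece is the
  difference of two termwise integrals, over \<open>(0, 1)\<close> and over \<open>(0, 1/2)\<close>; the first gives the zeta
  values, the second the values at \<open>1/2\<close>.
\<close>

section \<open>Nested harmonic sums as sums over decreasing tuples\<close>

fun mult_harm :: "nat \<Rightarrow> nat \<Rightarrow> real" where
  "mult_harm 0 n = 1"
| "mult_harm (Suc j) 0 = 0"
| "mult_harm (Suc j) (Suc n) = mult_harm (Suc j) n + mult_harm j n / real (Suc n)"

lemma mult_harm_nonneg: "mult_harm j n \<ge> 0"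
  by (induction j n rule: mult_harm.induct) auto

text \<open>These are the tails of the tuples in \<open>decreasing_tuples\<close> with leading entry
  \<open>Suc n\<close>. Since no \<open>hd\<close> occurs, the empty tuple is an ordinary
  case.\<close>

definition bounded_tuples :: "nat \<Rightarrow> nat \<Rightarrow> nat list set" where
  "bounded_tuples j n = {ks. length ks = j \<and> sorted_wrt (>) ks \<and> set ks \<subseteq> {1..n}}"

lemma finite_bounded_tuples: "finite (bounded_tuples j n)"
  by (rule finite_subset[OF _ finite_lists_length_eq[of "{1..n}" j]])
    (auto simp: bounded_tuples_def)

lemma bounded_tuples_0: "bounded_tuples 0 n = {[]}"
  by (auto simp: bounded_tuples_def)

lemma bounded_tuples_Suc_0: "bounded_tuples (Suc j) 0 = {}"
  by (auto simp: bounded_tuples_def length_Suc_conv)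

text \<open>The largest entry either equals \<open>Suc n\<close> or is at most \<open>n\<close>;
  this is the recursion of \<open>mult_harm\<close> at the level of index sets.\<close>

lemma bounded_tuples_Suc_Suc:
  "bounded_tuples (Suc j) (Suc n) = bounded_tuples (Suc j) n \<union> (#) (Suc n) ` bounded_tuples j n"
proof (intro equalityI subsetI)
  fix ks assume "ks \<in> bounded_tuples (Suc j) (Suc n)"
  then obtain i js where ks: "ks = i # js" "length js = j" "sorted_wrt (>) js"
      "\<And>x. x \<in> set js \<Longrightarrow> x < i \<and> 1 \<le> x" "1 \<le> i" "i \<le> Suc n"
    by (fastforce simp: bounded_tuples_def length_Suc_conv)
  show "ks \<in> bounded_tuples (Suc j) n \<union> (#) (Suc n) ` bounded_tuples j n"
  proof (cases "i = Suc n")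
    case True
    with ks have "js \<in> bounded_tuples j n"
      by (auto simp: bounded_tuples_def less_Suc_eq_le)
    with ks True show ?thesis by auto
  next
    case False
    with ks have "ks \<in> bounded_tuples (Suc j) n"
      by (fastforce simp: bounded_tuples_def)
    then show ?thesis by simp
  qed
next
  fix ks assume "ks \<in> bounded_tuples (Suc j) n \<union> (#) (Suc n) ` bounded_tuples j n"
  then show "ks \<in> bounded_tuples (Suc j) (Suc n)"
    by (fastforce simp: bounded_tuples_def)
qed

lemma sum_bounded_tuples:
  "(\<Sum>ks\<in>bounded_tuples j n. 1 / (\<Prod>i<j. real (ks ! i))) = mult_harm j n"
proof (induction j n rule: mult_harm.induct)
  case (3 j n)
  have "bounded_tuples (Suc j) n \<inter> (#) (Suc n) ` bounded_tuples j n = {}"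
    by (auto simp: bounded_tuples_def)
  then have "(\<Sum>ks\<in>bounded_tuples (Suc j) (Suc n). 1 / (\<Prod>i<Suc j. real (ks ! i))) =
      (\<Sum>ks\<in>bounded_tuples (Suc j) n. 1 / (\<Prod>i<Suc j. real (ks ! i))) +
      (\<Sum>ks\<in>bounded_tuples j n. 1 / (\<Prod>i<Suc j. real ((Suc n # ks) ! i)))"
    unfolding bounded_tuples_Suc_Suc
    by (subst sum.union_disjoint) (auto simp: finite_bounded_tuples sum.reindex)
  also have "(\<Sum>ks\<in>bounded_tuples j n. 1 / (\<Prod>i<Suc j. real ((Suc n # ks) ! i))) =
      (\<Sum>ks\<in>bounded_tuples j n. 1 / (\<Prod>i<j. real (ks ! i))) / real (Suc n)"
    unfolding prod.lessThan_Suc_shift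
    by (simp add: sum_divide_distrib mult.commute)
  finally show ?case using 3 by simp
qed (simp_all add: bounded_tuples_0 bounded_tuples_Suc_0)

lemma decreasing_tuples_Suc_0: "decreasing_tuples (Suc j) 0 = {}"
  by (auto simp: decreasing_tuples_def length_Suc_conv)

lemma decreasing_tuples_Suc_Suc:
  "decreasing_tuples (Suc j) (Suc n) = (#) (Suc n) ` bounded_tuples j n"
  by (fastforce simp: decreasing_tuples_def bounded_tuples_def length_Suc_conv less_Suc_eq_le)

text \<open>All series in question have exponents \<open>s, 1, ..., 1\<close> and a weight that
  depends on the leading index only. With that index fixed at \<open>Suc n\<close>, the sum over the
  others is \<open>mult_harm j n\<close>. No tuple has leading entry \<open>0\<close>, so the outer
  index can be shifted by one.\<close>

lemma nested_series_ones:
  assumes c: "\<And>n ks. c (n # ks) = d n"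
    and sm: "summable (\<lambda>n. d (Suc n) * mult_harm j n / real (Suc n) ^ s)"
  shows "nested_series c (s # replicate j 1) =
    (\<Sum>n. d (Suc n) * mult_harm j n / real (Suc n) ^ s)"
proof -
  define g where "g n = (\<Sum>ks\<in>decreasing_tuples (Suc j) n.
    c ks / (\<Prod>i<Suc j. real (ks ! i) ^ ((s # replicate j 1) ! i)))" for n
  have g0: "g 0 = 0"
    by (simp add: g_def decreasing_tuples_Suc_0)
  have gS: "g (Suc n) = d (Suc n) * mult_harm j n / real (Suc n) ^ s" for n
  proof -
    have "g (Suc n) = (\<Sum>ks\<in>bounded_tuples j n.
        d (Suc n) / (real (Suc n) ^ s * (\<Prod>i<j. real (ks ! i))))"
      unfolding g_def decreasing_tuples_Suc_Suc prod.lessThan_Suc_shift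
      by (simp add: sum.reindex c)
    also have "\<dots> = d (Suc n) / real (Suc n) ^ s *
        (\<Sum>ks\<in>bounded_tuples j n. 1 / (\<Prod>i<j. real (ks ! i)))"
      by (simp add: sum_distrib_left)
    finally show ?thesis by (simp add: sum_bounded_tuples)
  qed
  have "summable (\<lambda>n. g (Suc n))"
    unfolding gS by (rule sm)
  then have "suminf g = (\<Sum>n. g (Suc n))"
    using suminf_split_head[of g] by (simp add: summable_Suc_iff g0)
  moreover have "nested_series c (s # replicate j 1) = suminf g"
    unfolding nested_series_def g_def by (simp del: prod.lessThan_Suc)
  ultimately show ?thesis
    by (simp only: gS)
qed

section \<open>Convergence of series of nested harmonic sums\<close>

text \<open>
  The sums telescope: with \<open>1/((n+1)(n+2)) = 1/(n+1) - 1/(n+2)\<close>, summation by parts reduces \<open>j + 1\<close> to \<open>j\<close>.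
  This gives convergence without any estimate of the growth of the nested harmonic sums.
\<close>

lemma sum_mult_harm_le_1: "(\<Sum>n<M. mult_harm j n / (real (n + 1) * real (n + 2))) \<le> 1"
proof (induction j)
  case 0
  have "(\<Sum>n<M. mult_harm 0 n / (real (n + 1) * real (n + 2))) = 1 - 1 / real (M + 1)"
  proof (induction M)
    case (Suc M)
    have "1 / (real (M + 1) * real (M + 2)) = 1 / real (M + 1) - 1 / real (M + 2)"
      by (simp add: divide_simps)
    with Suc show ?case by simp
  qed simp
  then show ?case by simp
next
  case (Suc j)
  \<comment> \<open>Exact summation by parts; the boundary term at \<open>M\<close> is nonnegative
    and is dropped afterwards.\<close>
  have "(\<Sum>n<M. mult_harm (Suc j) n / (real (n + 1) * real (n + 2))) +
      mult_harm (Suc j) M / real (M + 1) =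
      (\<Sum>n<M. mult_harm j n / (real (n + 1) * real (n + 2)))"
  proof (induction M)
    case (Suc M)
    have "mult_harm (Suc j) M / (real (M + 1) * real (M + 2)) + mult_harm (Suc j) (Suc M) / real (M + 2) =
        mult_harm (Suc j) M / real (M + 1) + mult_harm j M / (real (M + 1) * real (M + 2))"
      by (simp add: divide_simps) (simp add: algebra_simps)
    with Suc show ?case by (simp del: mult_harm.simps)
  qed simp
  moreover have "mult_harm (Suc j) M / real (M + 1) \<ge> 0"
    by (simp add: mult_harm_nonneg)
  ultimately show ?case using Suc by linarith
qed

lemma summable_mult_harm:
  assumes "s \<ge> 2"
  shows "summable (\<lambda>n. mult_harm j n / real (Suc n) ^ s)"
proof (rule summable_comparison_test'[of _ 0])
  have "summable (\<lambda>n. mult_harm j n / (real (n + 1) * real (n + 2)))"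
    using sum_mult_harm_le_1[of j] by (intro summableI_nonneg_bounded[of _ 1])
      (auto simp: mult_harm_nonneg)
  then show "summable (\<lambda>n. 2 * (mult_harm j n / (real (n + 1) * real (n + 2))))"
    by (rule summable_mult)
  fix n :: nat
  \<comment> \<open>The factor 2 in the comparison series comes from
    \<open>n + 2 \<le> 2 * (n + 1)\<close>.\<close>
  have "(real (n + 1) * real (n + 2)) / 2 \<le> real (Suc n) ^ 2"
    by (simp add: power2_eq_square algebra_simps)
  also have "\<dots> \<le> real (Suc n) ^ s"
    using assms by (intro power_increasing) auto
  finally have "mult_harm j n / real (Suc n) ^ s \<le> mult_harm j n / (real (n + 1) * real (n + 2) / 2)"
    by (intro divide_left_mono mult_harm_nonneg mult_pos_pos) auto
  then show "norm (mult_harm j n / real (Suc n) ^ s) \<le>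
      2 * (mult_harm j n / (real (n + 1) * real (n + 2)))"
    using mult_harm_nonneg[of j n] by (simp add: field_simps)
qed


section \<open>Generating functions of the nested harmonic sums\<close>

text \<open>In this form the sum is recognizable as a coefficient of a Cauchy product with the
  geometric series.\<close>

lemma mult_harm_Suc_Suc_eq_sum:
  "mult_harm (Suc j) (Suc n) = (\<Sum>i\<le>n. mult_harm j i / real (Suc i))"
  by (induction n) simp_all

text \<open>The difference \<open>D\<close> of the integrated series and its claimed value has
  derivative zero on \<open>(-1, 1)\<close> and vanishes at \<open>0\<close>. The coefficients are
  arbitrary so that the lemma can serve inside the induction that identifies them; absolute
  convergence is what the Cauchy product there requires.\<close>

lemma log_power_sums_integrate:
  fixes u :: real
  assumes sums: "\<And>u::real. \<bar>u\<bar> < 1 \<Longrightarrow> (\<lambda>n. c n * u ^ n) sums ((- ln (1 - u)) ^ j / fact j / (1 - u))"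
    and u: "\<bar>u\<bar> < 1"
  shows "summable (\<lambda>n. norm (c n / real (Suc n) * u ^ Suc n))"
    and "(\<lambda>n. c n / real (Suc n) * u ^ Suc n) sums ((- ln (1 - u)) ^ Suc j / fact (Suc j))"
proof -
  \<comment> \<open>Convergence at \<open>(1 + \<bar>v\<bar>) / 2\<close>, strictly between
    \<open>\<bar>v\<bar>\<close> and \<open>1\<close>, forces absolute convergence at
    \<open>v\<close>.\<close>
  have abs: "summable (\<lambda>n. norm (c n * v ^ n))" if "\<bar>v\<bar> < 1" for v :: real
  proof (rule powser_insidea[where f = c and x = "(1 + \<bar>v\<bar>) / 2"])
    show "summable (\<lambda>n. c n * ((1 + \<bar>v\<bar>) / 2) ^ n)"
      using sums[of "(1 + \<bar>v\<bar>) / 2"] that by (simp add: sums_iff)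
  qed (use that in auto)
  have abs_int: "summable (\<lambda>n. norm (c n / real (Suc n) * v ^ Suc n))" if "\<bar>v\<bar> < 1" for v :: real
  proof (rule summable_comparison_test'[of _ 0])
    show "summable (\<lambda>n. norm (c n * v ^ n))" by (rule abs[OF that])
  next
    fix n :: nat
    have "\<bar>v\<bar> / real (Suc n) \<le> 1"
      using that by (simp add: divide_simps)
    then have "\<bar>c n * v ^ n\<bar> * (\<bar>v\<bar> / real (Suc n)) \<le> \<bar>c n * v ^ n\<bar>"
      by (intro mult_left_le) auto
    then show "norm (norm (c n / real (Suc n) * v ^ Suc n)) \<le> norm (c n * v ^ n)"
      by (simp add: abs_mult field_simps)
  qed
  from abs_int[OF u] show "summable (\<lambda>n. norm (c n / real (Suc n) * u ^ Suc n))" .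
  define D where "D v = (\<Sum>n. c n / real (Suc n) * v ^ Suc n) - (- ln (1 - v)) ^ Suc j / fact (Suc j)" for v :: real
  have DERIV_D: "DERIV D v :> 0" if v: "\<bar>v\<bar> < 1" for v :: real
  proof -
    have "DERIV (\<lambda>v. \<Sum>n. c n / real (Suc n) * v ^ Suc n) v :>
        (\<Sum>n. c n / real (Suc n) * real (Suc n) * v ^ n)"
    proof (rule DERIV_power_series'[where R = 1])
      fix x :: real assume "x \<in> {-1<..<1}"
      then show "summable (\<lambda>n. c n / real (Suc n) * real (Suc n) * x ^ n)"
        using sums[of x] by (simp add: sums_iff abs_less_iff)
    qed (use v in auto)
    moreover have "(\<Sum>n. c n / real (Suc n) * real (Suc n) * v ^ n) =
        (- ln (1 - v)) ^ j / fact j / (1 - v)"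
      using sums[OF v] by (simp add: sums_iff)
    moreover have "DERIV (\<lambda>v. (- ln (1 - v)) ^ Suc j / fact (Suc j)) v :>
        (- ln (1 - v)) ^ j / fact j / (1 - v)"
      using v by (auto intro!: derivative_eq_intros simp del: fact_Suc power_Suc)
        (simp add: divide_simps)
    ultimately show ?thesis
      unfolding D_def using DERIV_diff by fastforce
  qed
  have "D u = D 0"
    by (rule DERIV_isconst3[of "-1" 1]) (use u DERIV_D in auto)
  also have "D 0 = 0"
    by (simp add: D_def)
  finally have "(\<Sum>n. c n / real (Suc n) * u ^ Suc n) = (- ln (1 - u)) ^ Suc j / fact (Suc j)"
    by (simp add: D_def)
  with summable_norm_cancel[OF abs_int[OF u]]
  show "(\<lambda>n. c n / real (Suc n) * u ^ Suc n) sums ((- ln (1 - u)) ^ Suc j / fact (Suc j))"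
    by (simp add: sums_iff)
qed

text \<open>Passing from \<open>j\<close> to \<open>j + 1\<close> takes two moves: integrate the
  series, which raises the power of the logarithm, then multiply by \<open>1 / (1 - u)\<close>,
  which turns coefficients into partial sums.\<close>

lemma log_power_geometric_sums:
  fixes u :: real
  assumes "\<bar>u\<bar> < 1"
  shows "(\<lambda>n. mult_harm j n * u ^ n) sums ((- ln (1 - u)) ^ j / fact j / (1 - u))"
  using assms
proof (induction j arbitrary: u)
  case 0
  then show ?case using geometric_sums[of u] by simp
next
  case (Suc j)
  have geo: "summable (\<lambda>n. norm (u ^ n))"
    unfolding norm_power using Suc.prems by (intro summable_geometric) simp
  have "(\<lambda>k. \<Sum>i\<le>k. (mult_harm j i / real (Suc i) * u ^ Suc i) * u ^ (k - i)) sums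
      ((- ln (1 - u)) ^ Suc j / fact (Suc j) * (1 / (1 - u)))"
    using Cauchy_product_sums[OF log_power_sums_integrate(1)[OF Suc.IH Suc.prems] geo]
      log_power_sums_integrate(2)[OF Suc.IH Suc.prems] suminf_geometric[of u] Suc.prems
    by (simp only: sums_iff real_norm_def)
  also have "(\<lambda>k. \<Sum>i\<le>k. (mult_harm j i / real (Suc i) * u ^ Suc i) * u ^ (k - i)) =
      (\<lambda>k. mult_harm (Suc j) (Suc k) * u ^ Suc k)"
    unfolding mult_harm_Suc_Suc_eq_sum sum_distrib_right
    by (intro ext sum.cong refl) (simp add: mult.assoc flip: power_add)
  \<comment> \<open>The product starts at \<open>u ^ 1\<close>; the missing constant term is
    \<open>mult_harm (Suc j) 0 = 0\<close>.\<close>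
  finally show ?case
    using sums_Suc[of "\<lambda>k. mult_harm (Suc j) k * u ^ k"] by simp
qed

lemma log_power_sums:
  fixes u :: real
  assumes "\<bar>u\<bar> < 1"
  shows "(\<lambda>n. mult_harm j n / real (Suc n) * u ^ Suc n) sums ((- ln (1 - u)) ^ Suc j / fact (Suc j))"
  by (rule log_power_sums_integrate(2)[OF log_power_geometric_sums assms])

section \<open>Logarithmic moments of monomials\<close>

text \<open>\<open>log_moment n N a\<close> is \<open>\<integral>\<^sub>0\<^sup>a x\<^sup>n (-ln x)\<^sup>N dx\<close>; the recursion is integration by parts.\<close>

primrec log_moment :: "nat \<Rightarrow> nat \<Rightarrow> real \<Rightarrow> real" where
  "log_moment n 0 a = a ^ Suc n / real (Suc n)"
| "log_moment n (Suc N) a =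
     (- ln a) ^ Suc N * a ^ Suc n / real (Suc n) + real (Suc N) / real (Suc n) * log_moment n N a"

text \<open>Unrolling the recursion accumulates the falling factorial
  \<open>N (N - 1) ... (N - l + 1)\<close>, which is \<open>fact l * (N choose l)\<close>. This
  finite sum is the source of the sums over \<open>l\<close> in the theorem.\<close>

lemma log_moment_eq_sum:
  "log_moment n N a =
     (\<Sum>l\<le>N. fact l * real (N choose l) * (- ln a) ^ (N - l) * a ^ Suc n / real (Suc n) ^ Suc l)"
proof (induction N)
  case (Suc N)
  have "fact (Suc l) * real (Suc N choose Suc l) = real (Suc N) * (fact l * real (N choose l))" for l
  proof -
    have "fact (Suc l) * real (Suc N choose Suc l) = fact l * real (Suc l * (Suc N choose Suc l))"
      by (simp add: algebra_simps)
    also have "\<dots> = fact l * real (Suc N * (N choose l))"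
      by (simp only: Suc_times_binomial)
    finally show ?thesis by (simp add: algebra_simps)
  qed
  then have "(\<Sum>l\<le>N. fact (Suc l) * real (Suc N choose Suc l) * (- ln a) ^ (N - l) * a ^ Suc n / real (Suc n) ^ Suc (Suc l)) =
      real (Suc N) / real (Suc n) * log_moment n N a"
    unfolding Suc.IH sum_distrib_left
    by (intro sum.cong refl) (simp add: field_simps del: fact_Suc binomial_Suc_Suc)
  then show ?case
    by (simp add: sum.atMost_Suc_shift del: sum.atMost_Suc fact_Suc binomial_Suc_Suc power_Suc)
qed simp

text \<open>The boundary terms that carry a logarithm vanish since \<open>ln 1 = 0\<close>, so an
  integral over \<open>(0, 1)\<close> yields a single zeta value.\<close>

lemma log_moment_1: "log_moment n N 1 = fact N / real (Suc n) ^ Suc N"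
  by (induction N) (simp_all add: field_simps)

lemma DERIV_log_moment:
  assumes "x > 0"
  shows "DERIV (log_moment n N) x :> x ^ n * (- ln x) ^ N"
proof (induction N)
  case 0
  have "log_moment n 0 = (\<lambda>x. x ^ Suc n / real (Suc n))"
    by (intro ext) simp
  then show ?case
    by (auto intro!: derivative_eq_intros simp del: power_Suc)
next
  case (Suc N)
  have eq: "log_moment n (Suc N) = (\<lambda>x. (- ln x) ^ Suc N * x ^ Suc n / real (Suc n) +
      real (Suc N) / real (Suc n) * log_moment n N x)"
    by (intro ext) simp
  show ?case unfolding eq
  proof (rule DERIV_cong)
    show "DERIV (\<lambda>x. (- ln x) ^ Suc N * x ^ Suc n / real (Suc n) +
        real (Suc N) / real (Suc n) * log_moment n N x) x :>
        (real (Suc N) * (- ln x) ^ N * (- 1 / x) * x ^ Suc n +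
          (- ln x) ^ Suc N * (real (Suc n) * x ^ n)) / real (Suc n) +
        real (Suc N) / real (Suc n) * (x ^ n * (- ln x) ^ N)"
      using assms by (auto intro!: derivative_eq_intros Suc.IH simp del: power_Suc)
        (simp add: mult_ac)
    \<comment> \<open>Differentiating the power of the logarithm gives a term that cancels the
      recursive one; \<open>a\<close>, \<open>b\<close>, \<open>c\<close> stand for the expressions
      with powers of \<open>ln x\<close>.\<close>
    have key: "(a * (- 1 / x) * x ^ Suc n + b * (real (Suc n) * x ^ n)) / real (Suc n) +
        real (Suc N) / real (Suc n) * c = x ^ n * b" if "real (Suc N) * c = a * x ^ n" for a b c
      using that assms by (simp add: divide_simps)
    show "(real (Suc N) * (- ln x) ^ N * (- 1 / x) * x ^ Suc n +
          (- ln x) ^ Suc N * (real (Suc n) * x ^ n)) / real (Suc n) +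
        real (Suc N) / real (Suc n) * (x ^ n * (- ln x) ^ N) = x ^ n * (- ln x) ^ Suc N"
      by (rule key) (simp add: mult_ac)
  qed
qed

lemma tendsto_log_moment_0: "(log_moment n N \<longlongrightarrow> 0) (at_right 0)"
proof (induction N)
  case 0
  have "log_moment n 0 = (\<lambda>x. x ^ Suc n / real (Suc n))"
    by (intro ext) simp
  then show ?case
    by (auto intro!: tendsto_eq_intros)
next
  case (Suc N)
  \<comment> \<open>One factor \<open>x\<close> stays with the logarithm to force the limit
    \<open>0\<close>: for \<open>n = 0\<close> the remaining \<open>x ^ n\<close> does not tend to
    \<open>0\<close>.\<close>
  have eq: "log_moment n (Suc N) = (\<lambda>x. ((- ln x) ^ Suc N * x) * x ^ n / real (Suc n) +
      real (Suc N) / real (Suc n) * log_moment n N x)"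
    by (intro ext) simp
  have "((\<lambda>x::real. (- ln x) ^ Suc N * x) \<longlongrightarrow> 0) (at_right 0)"
    by real_asymp
  moreover have "((\<lambda>x::real. x ^ n / real (Suc n)) \<longlongrightarrow> 0 ^ n / real (Suc n)) (at_right 0)"
    by (intro tendsto_intros) auto
  ultimately have "((\<lambda>x::real. ((- ln x) ^ Suc N * x) * (x ^ n / real (Suc n))) \<longlongrightarrow> 0 * (0 ^ n / real (Suc n))) (at_right 0)"
    by (rule tendsto_mult)
  from tendsto_add[OF this tendsto_mult_left[OF Suc.IH, of "real (Suc N) / real (Suc n)"]]
  show ?case unfolding eq
    by (simp only: times_divide_eq_right mult_zero_left mult_zero_right div_0 add_0)
qed

text \<open>\<open>log_moment n N\<close> is an antiderivative with limit \<open>0\<close> at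
  \<open>0\<close>. The bound \<open>a \<le> 1\<close> makes the integrand nonnegative, so the
  improper fundamental theorem also yields absolute integrability.\<close>

lemma integral_monomial_log:
  assumes "0 < a" "a \<le> 1"
  shows "(\<lambda>x. x ^ n * (- ln x) ^ N) absolutely_integrable_on {0<..<a}"
    and "integral {0<..<a} (\<lambda>x. x ^ n * (- ln x) ^ N) = log_moment n N a"
proof -
  have pos: "0 \<le> x ^ n * (- ln x) ^ N" if "0 < x" "x < a" for x
    using that assms by (intro mult_nonneg_nonneg zero_le_power) auto
  have A: "((log_moment n N \<circ> real_of_ereal) \<longlongrightarrow> 0) (at_right 0)"
    using tendsto_log_moment_0[of n N] unfolding zero_ereal_def
    by (simp add: ereal_tendsto_simps)
  have "isCont (log_moment n N) a"
    using DERIV_log_moment[OF assms(1)] by (rule DERIV_isCont)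
  then have B: "((log_moment n N \<circ> real_of_ereal) \<longlongrightarrow> log_moment n N a) (at_left (ereal a))"
    by (simp add: ereal_tendsto_simps isCont_def filterlim_at_split)
  have E: "einterval 0 (ereal a) = {0<..<a}"
    by (auto simp: einterval_def)
  have D: "DERIV (log_moment n N) x :> x ^ n * (- ln x) ^ N" if "0 < ereal x" for x
    using that by (intro DERIV_log_moment) simp
  have C: "isCont (\<lambda>x. x ^ n * (- ln x) ^ N) x" if "0 < ereal x" for x
    using that by (intro continuous_intros) auto
  have P: "AE x in lborel. 0 < ereal x \<longrightarrow> ereal x < ereal a \<longrightarrow> 0 \<le> x ^ n * (- ln x) ^ N"
    using pos by (intro AE_I2) auto
  have lt: "0 < ereal a"
    using assms by simp
  note si = interval_integral_FTC_nonneg(1)[OF lt D C P A B, unfolded E]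
  note ii = interval_integral_FTC_nonneg(2)[OF lt D C P A B]
  show "(\<lambda>x. x ^ n * (- ln x) ^ N) absolutely_integrable_on {0<..<a}"
    using set_borel_integral_eq_integral(1)[OF si] pos
    by (intro nonnegative_absolutely_integrable_1) auto
  show "integral {0<..<a} (\<lambda>x. x ^ n * (- ln x) ^ N) = log_moment n N a"
    using interval_integral_eq_integral'[of 0 "ereal a" "\<lambda>x. x ^ n * (- ln x) ^ N"] si ii assms
    by (simp add: E)
qed

section \<open>Termwise integration of power series against powers of the logarithm\<close>

text \<open>The monomial integrands are nonnegative, so hypothesis \<open>sm\<close> says exactly
  that the L1 norms of the terms are summable, which justifies exchanging sum and integral.\<close>

lemma integral_power_series_log:
  assumes a: "0 < a" "a \<le> 1"
    and f: "\<And>x. 0 < x \<Longrightarrow> x < a \<Longrightarrow> (\<lambda>n. c n * x ^ n) sums f x"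
    and sm: "summable (\<lambda>n. \<bar>c n\<bar> * log_moment n N a)"
  shows "(\<lambda>x. f x * (- ln x) ^ N) absolutely_integrable_on {0<..<a}"
    and "integral {0<..<a} (\<lambda>x. f x * (- ln x) ^ N) = (\<Sum>n. c n * log_moment n N a)"
proof -
  define S where "S = {0<..<a}"
  have S: "S \<in> sets lebesgue"
    by (simp add: S_def)
  define M where "M = lebesgue_on S"
  define g where "g n x = c n * (x ^ n * (- ln x) ^ N)" for n x
  have int_abs: "h absolutely_integrable_on S \<longleftrightarrow> integrable M h" for h :: "real \<Rightarrow> real"
    using S by (simp add: M_def set_integrable_def integrable_restrict_space)
  have int_eq: "integral S h = integral\<^sup>L M h" if "integrable M h" for h :: "real \<Rightarrow> real"
    using set_lebesgue_integral_eq_integral(2)[of S h] that S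
    by (simp add: int_abs set_lebesgue_integral_def M_def integral_restrict_space)
  have mono: "integrable M (\<lambda>x. x ^ n * (- ln x) ^ N)"
    "integral\<^sup>L M (\<lambda>x. x ^ n * (- ln x) ^ N) = log_moment n N a" for n
    using integral_monomial_log[OF a, of n N] int_abs int_eq by (auto simp: S_def)
  have pos: "0 \<le> x ^ n * (- ln x) ^ N" if "x \<in> S" for x n
    using that a by (intro mult_nonneg_nonneg zero_le_power) (auto simp: S_def)
  have g_int: "integrable M (g n)" for n
    unfolding g_def by (intro integrable_mult_right mono)
  have g_integral: "integral\<^sup>L M (g n) = c n * log_moment n N a" for n
    unfolding g_def by (simp add: mono)
  have norm_eq: "integral\<^sup>L M (\<lambda>x. norm (g n x)) = \<bar>c n\<bar> * log_moment n N a" for n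
  proof -
    have "integral\<^sup>L M (\<lambda>x. norm (g n x)) = integral\<^sup>L M (\<lambda>x. \<bar>c n\<bar> * (x ^ n * (- ln x) ^ N))"
      using pos by (intro Bochner_Integration.integral_cong refl)
        (simp add: g_def M_def abs_mult[of "c n"] abs_of_nonneg del: abs_mult_pos abs_mult_pos')
    then show ?thesis
      by (simp add: mono)
  qed
  have g_sums: "(\<lambda>n. g n x) sums (f x * (- ln x) ^ N)" if "x \<in> S" for x
    using sums_mult2[OF f[of x], of "(- ln x) ^ N"] that
    by (simp add: g_def S_def mult.assoc)
  have abs: "summable (\<lambda>n. norm (g n x))" if "x \<in> S" for x
  proof -
    have "summable (\<lambda>n. norm (c n * x ^ n))"
    \<comment> \<open>Any point strictly between \<open>x\<close> and \<open>a\<close> would do; the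
      midpoint is chosen.\<close>
    proof (rule powser_insidea[where f = c and x = "(x + a) / 2"])
      show "summable (\<lambda>n. c n * ((x + a) / 2) ^ n)"
        using f[of "(x + a) / 2"] that by (simp add: sums_iff S_def)
    qed (use that in \<open>auto simp: S_def\<close>)
    from summable_mult2[OF this, of "norm ((- ln x) ^ N)"]
    show ?thesis by (simp add: g_def abs_mult mult.assoc)
  qed
  have AE: "AE x in M. summable (\<lambda>n. norm (g n x))"
    using abs by (intro AE_I2) (simp add: M_def)
  have sm': "summable (\<lambda>n. integral\<^sup>L M (\<lambda>x. norm (g n x)))"
    unfolding norm_eq by (rule sm)
  have cong: "(\<Sum>n. g n x) = f x * (- ln x) ^ N" if "x \<in> space M" for x
    using g_sums[of x] that by (simp add: sums_iff M_def)
  have 1: "integrable M (\<lambda>x. f x * (- ln x) ^ N)"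
    using integrable_suminf[OF g_int AE sm'] cong
    by (subst Bochner_Integration.integrable_cong[OF refl cong[symmetric]])
  have "integral\<^sup>L M (\<lambda>x. f x * (- ln x) ^ N) = integral\<^sup>L M (\<lambda>x. \<Sum>n. g n x)"
    using cong by (intro Bochner_Integration.integral_cong) auto
  also have "\<dots> = (\<Sum>n. c n * log_moment n N a)"
    unfolding integral_suminf[OF g_int AE sm'] by (simp add: g_integral)
  finally show "integral {0<..<a} (\<lambda>x. f x * (- ln x) ^ N) = (\<Sum>n. c n * log_moment n N a)"
    using int_eq[OF 1] by (simp add: S_def)
  show "(\<lambda>x. f x * (- ln x) ^ N) absolutely_integrable_on {0<..<a}"
    using 1 int_abs by (simp add: S_def)
qed


text \<open>Meant for \<open>a = 1/2\<close>. At \<open>a = 1\<close> the series for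
  \<open>l = 0\<close> can diverge, and \<open>log_moment_1\<close> is applied there
  instead.\<close>

lemma suminf_log_moment:
  assumes "\<And>l. l \<le> N \<Longrightarrow> summable (\<lambda>n. c n * a ^ Suc n / real (Suc n) ^ Suc l)"
  shows "summable (\<lambda>n. c n * log_moment n N a)"
    and "(\<Sum>n. c n * log_moment n N a) =
      (\<Sum>l\<le>N. fact l * real (N choose l) * (- ln a) ^ (N - l) *
        (\<Sum>n. c n * a ^ Suc n / real (Suc n) ^ Suc l))"
proof -
  have eq: "c n * log_moment n N a =
      (\<Sum>l\<le>N. fact l * real (N choose l) * (- ln a) ^ (N - l) *
        (c n * a ^ Suc n / real (Suc n) ^ Suc l))" for n
    unfolding log_moment_eq_sum sum_distrib_left
    by (intro sum.cong refl) (simp add: field_simps)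
  have sm: "summable (\<lambda>n. fact l * real (N choose l) * (- ln a) ^ (N - l) *
        (c n * a ^ Suc n / real (Suc n) ^ Suc l))" if "l \<in> {..N}" for l
    using that by (intro summable_mult assms) auto
  show "summable (\<lambda>n. c n * log_moment n N a)"
    unfolding eq using sm by (intro summable_sum)
  show "(\<Sum>n. c n * log_moment n N a) =
      (\<Sum>l\<le>N. fact l * real (N choose l) * (- ln a) ^ (N - l) *
        (\<Sum>n. c n * a ^ Suc n / real (Suc n) ^ Suc l))"
  proof -
    have "(\<Sum>n. c n * log_moment n N a) =
        (\<Sum>l\<le>N. \<Sum>n. fact l * real (N choose l) * (- ln a) ^ (N - l) *
          (c n * a ^ Suc n / real (Suc n) ^ Suc l))"
      unfolding eq by (rule suminf_sum) (rule sm)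
    also have "\<dots> = (\<Sum>l\<le>N. fact l * real (N choose l) * (- ln a) ^ (N - l) *
        (\<Sum>n. c n * a ^ Suc n / real (Suc n) ^ Suc l))"
      by (intro sum.cong refl suminf_mult assms) simp
    finally show ?thesis .
  qed
qed

section \<open>Multiple zeta and polylogarithm values as series in \<open>mult_harm\<close>\<close>

lemma mzeta_ones:
  assumes "s \<ge> 2"
  shows "mzeta (s # replicate j 1) = (\<Sum>n. mult_harm j n / real (Suc n) ^ s)"
  unfolding mzeta_def
  by (subst nested_series_ones[where d = "\<lambda>_. 1"]) (use summable_mult_harm[OF assms] in simp_all)

text \<open>Dominated by the generating function at \<open>\<bar>x\<bar>\<close>, whatever the
  exponent; \<open>s = 1\<close> does occur in the theorem.\<close>

lemma summable_mult_harm_power: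
  fixes x :: real
  assumes "\<bar>x\<bar> < 1"
  shows "summable (\<lambda>n. x ^ Suc n * mult_harm j n / real (Suc n) ^ s)"
proof (rule summable_comparison_test'[of _ 0])
  show "summable (\<lambda>n. mult_harm j n * \<bar>x\<bar> ^ n)"
    using log_power_geometric_sums[of "\<bar>x\<bar>" j] assms by (simp add: sums_iff)
  fix n :: nat
  have "norm (x ^ Suc n * mult_harm j n / real (Suc n) ^ s) =
      (mult_harm j n * \<bar>x\<bar> ^ n) * (\<bar>x\<bar> / real (Suc n) ^ s)"
    using mult_harm_nonneg[of j n] by (simp add: abs_mult power_abs)
  also have "\<dots> \<le> mult_harm j n * \<bar>x\<bar> ^ n"
  proof (rule mult_left_le)
    have "\<bar>x\<bar> / real (Suc n) ^ s \<le> \<bar>x\<bar> / 1"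
      by (intro divide_left_mono one_le_power) auto
    then show "\<bar>x\<bar> / real (Suc n) ^ s \<le> 1"
      using assms by linarith
  qed (simp add: mult_harm_nonneg)
  finally show "norm (x ^ Suc n * mult_harm j n / real (Suc n) ^ s) \<le> mult_harm j n * \<bar>x\<bar> ^ n" .
qed

lemma mzeta_at_ones:
  assumes "\<bar>x\<bar> < 1"
  shows "mzeta_at (s # replicate j 1) x = (\<Sum>n. x ^ Suc n * mult_harm j n / real (Suc n) ^ s)"
  unfolding mzeta_at_def
  by (subst nested_series_ones[where d = "\<lambda>n. x ^ n"])
    (use summable_mult_harm_power[OF assms] in \<open>simp_all del: power_Suc\<close>)

lemma mzeta_at_eq_Li: "\<bar>x\<bar> < 1 \<Longrightarrow> mzeta_at [s] x = Li s x"
  using mzeta_at_ones[of x s 0] by (simp add: Li_def)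

section \<open>Integrals over \<open>(1/2, 1)\<close>\<close>

lemma integral_Ioo_split:
  fixes f :: "real \<Rightarrow> real"
  assumes f: "f absolutely_integrable_on {a<..<b}" and c: "a \<le> c" "c \<le> b"
  shows "f absolutely_integrable_on {c<..<b}"
    and "integral {c<..<b} f = integral {a<..<b} f - integral {a<..<c} f"
proof -
  show "f absolutely_integrable_on {c<..<b}"
    by (rule set_integrable_subset[OF f]) (use c in auto)
  have "f integrable_on {a..b}"
    using f set_lebesgue_integral_eq_integral(1) integrable_on_open_interval_real by blast
  from Henstock_Kurzweil_Integration.integral_combine[OF c this]
  show "integral {c<..<b} f = integral {a<..<b} f - integral {a<..<c} f"
    by (simp add: integral_open_interval_real)
qed

text \<open>Common form of two families: \<open>e = 0\<close> is the generating function,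
  \<open>e = 1\<close> its primitive divided by \<open>x\<close>. The condition on
  \<open>e + N\<close> makes the leading exponent of the zeta value at least 2.\<close>

lemma integral_mult_harm_series:
  assumes f: "\<And>x. 0 < x \<Longrightarrow> x < 1 \<Longrightarrow> (\<lambda>n. K * mult_harm j n / real (Suc n) ^ e * x ^ n) sums f x"
    and K: "K \<ge> 0" and e: "e + N \<ge> 1"
  shows "(\<lambda>x. f x * (- ln x) ^ N) absolutely_integrable_on {1/2<..<1::real}"
    and "integral {1/2<..<1} (\<lambda>x. f x * (- ln x) ^ N) =
      K * (fact N * mzeta ((e + N + 1) # replicate j 1) -
        (\<Sum>l\<le>N. fact l * real (N choose l) * ln 2 ^ (N - l) *
          mzeta_at ((e + l + 1) # replicate j 1) (1/2)))"
proof -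
  define c where "c n = K * mult_harm j n / real (Suc n) ^ e" for n
  have c_nonneg: "\<bar>c n\<bar> = c n" for n
    using K by (simp add: c_def mult_harm_nonneg)
  have c1: "c n * log_moment n N 1 = K * fact N * (mult_harm j n / real (Suc n) ^ (e + N + 1))" for n
    unfolding log_moment_1 by (simp add: c_def power_add mult_ac)
  have sm1: "summable (\<lambda>n. c n * log_moment n N 1)"
    unfolding c1 using e by (intro summable_mult summable_mult_harm) simp
  have sum1: "(\<Sum>n. c n * log_moment n N 1) = K * fact N * mzeta ((e + N + 1) # replicate j 1)"
  proof -
    have "e + N + 1 \<ge> 2" using e by simp
    from mzeta_ones[OF this] suminf_mult[OF summable_mult_harm[OF this]] show ?thesis
      unfolding c1 by (simp only:)
  qed
  have c2: "c n * (1/2) ^ Suc n / real (Suc n) ^ Suc l =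
      K * ((1/2) ^ Suc n * mult_harm j n / real (Suc n) ^ (e + l + 1))" for n l
    by (simp add: c_def power_add mult_ac)
  have sm2': "summable (\<lambda>n. c n * (1/2) ^ Suc n / real (Suc n) ^ Suc l)" for l
    unfolding c2 by (intro summable_mult summable_mult_harm_power) simp
  have sum2': "(\<Sum>n. c n * (1/2) ^ Suc n / real (Suc n) ^ Suc l) =
      K * mzeta_at ((e + l + 1) # replicate j 1) (1/2)" for l
  proof -
    have "\<bar>1/2::real\<bar> < 1" by simp
    from mzeta_at_ones[OF this] suminf_mult[OF summable_mult_harm_power[OF this]] show ?thesis
      unfolding c2 by (simp only:)
  qed
  note sm2 = suminf_log_moment(1)[of N c "1/2", OF sm2']
  have "(\<Sum>n. c n * log_moment n N (1/2)) = (\<Sum>l\<le>N. fact l * real (N choose l) * ln 2 ^ (N - l) *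
          (K * mzeta_at ((e + l + 1) # replicate j 1) (1/2)))"
    unfolding suminf_log_moment(2)[of N c "1/2", OF sm2'] sum2' by (simp add: ln_div)
  then have sum2: "(\<Sum>n. c n * log_moment n N (1/2)) = K * (\<Sum>l\<le>N. fact l * real (N choose l) * ln 2 ^ (N - l) *
          mzeta_at ((e + l + 1) # replicate j 1) (1/2))"
    by (simp add: sum_distrib_left mult_ac)
  have f': "(\<lambda>n. c n * x ^ n) sums f x" if "0 < x" "x < 1" for x
    using f[OF that] by (simp add: c_def)
  have I1: "(\<lambda>x. f x * (- ln x) ^ N) absolutely_integrable_on {0<..<1}"
    "integral {0<..<1} (\<lambda>x. f x * (- ln x) ^ N) = (\<Sum>n. c n * log_moment n N 1)"
    by (rule integral_power_series_log[where c = c], use f' sm1 c_nonneg in auto)+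
  have I2: "integral {0<..<1/2} (\<lambda>x. f x * (- ln x) ^ N) = (\<Sum>n. c n * log_moment n N (1/2))"
    by (rule integral_power_series_log[where c = c]) (use f' sm2 c_nonneg in auto)
  show "(\<lambda>x. f x * (- ln x) ^ N) absolutely_integrable_on {1/2<..<1::real}"
    by (rule integral_Ioo_split[OF I1(1)]) auto
  show "integral {1/2<..<1} (\<lambda>x. f x * (- ln x) ^ N) =
      K * (fact N * mzeta ((e + N + 1) # replicate j 1) -
        (\<Sum>l\<le>N. fact l * real (N choose l) * ln 2 ^ (N - l) *
          mzeta_at ((e + l + 1) # replicate j 1) (1/2)))"
    using integral_Ioo_split(2)[OF I1(1), of "1/2"] I1(2) I2 sum1 sum2
    by (simp add: right_diff_distrib)
qed

text \<open>The case \<open>e = 0\<close>. At least one factor \<open>- ln u\<close> has to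
  compensate the pole of \<open>1 / (1 - u)\<close> at \<open>1\<close>.\<close>

lemma integral_log_power_over_complement:
  assumes "N \<ge> 1"
  shows "(\<lambda>u. (- ln (1 - u)) ^ j / (1 - u) * (- ln u) ^ N) absolutely_integrable_on {1/2<..<1::real}"
    and "integral {1/2<..<1} (\<lambda>u. (- ln (1 - u)) ^ j / (1 - u) * (- ln u) ^ N) =
      fact j * (fact N * mzeta ((N + 1) # replicate j 1) -
        (\<Sum>l\<le>N. fact l * real (N choose l) * ln 2 ^ (N - l) *
          mzeta_at ((l + 1) # replicate j 1) (1/2)))"
proof -
  have f: "(\<lambda>n. fact j * mult_harm j n / real (Suc n) ^ 0 * u ^ n) sums ((- ln (1 - u)) ^ j / (1 - u))"
    if "0 < u" "u < 1" for u :: real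
    using sums_mult[OF log_power_geometric_sums[of u j], of "fact j"] that
    by (simp add: mult.assoc)
  show "(\<lambda>u. (- ln (1 - u)) ^ j / (1 - u) * (- ln u) ^ N) absolutely_integrable_on {1/2<..<1::real}"
    by (rule integral_mult_harm_series(1)[OF f]) (use assms in auto)
  show "integral {1/2<..<1} (\<lambda>u. (- ln (1 - u)) ^ j / (1 - u) * (- ln u) ^ N) =
      fact j * (fact N * mzeta ((N + 1) # replicate j 1) -
        (\<Sum>l\<le>N. fact l * real (N choose l) * ln 2 ^ (N - l) *
          mzeta_at ((l + 1) # replicate j 1) (1/2)))"
    using integral_mult_harm_series(2)[OF f, of N] assms by simp
qed

text \<open>The case \<open>e = 1\<close>. The exponent \<open>Suc j\<close> ensures a factor
  \<open>- ln (1 - u)\<close>, which compensates the pole of \<open>1 / u\<close> at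
  \<open>0\<close>.\<close>

lemma integral_log_power_over_id:
  shows "(\<lambda>u. (- ln (1 - u)) ^ Suc j / u * (- ln u) ^ N) absolutely_integrable_on {1/2<..<1::real}"
    and "integral {1/2<..<1} (\<lambda>u. (- ln (1 - u)) ^ Suc j / u * (- ln u) ^ N) =
      fact (Suc j) * (fact N * mzeta ((N + 2) # replicate j 1) -
        (\<Sum>l\<le>N. fact l * real (N choose l) * ln 2 ^ (N - l) *
          mzeta_at ((l + 2) # replicate j 1) (1/2)))"
proof -
  have f: "(\<lambda>n. fact (Suc j) * mult_harm j n / real (Suc n) ^ 1 * u ^ n) sums ((- ln (1 - u)) ^ Suc j / u)"
    if "0 < u" "u < 1" for u :: real
    using sums_mult[OF log_power_sums[of u j], of "fact (Suc j) / u"] that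
    by (simp add: mult.assoc)
  show "(\<lambda>u. (- ln (1 - u)) ^ Suc j / u * (- ln u) ^ N) absolutely_integrable_on {1/2<..<1::real}"
    by (rule integral_mult_harm_series(1)[OF f]) auto
  show "integral {1/2<..<1} (\<lambda>u. (- ln (1 - u)) ^ Suc j / u * (- ln u) ^ N) =
      fact (Suc j) * (fact N * mzeta ((N + 2) # replicate j 1) -
        (\<Sum>l\<le>N. fact l * real (N choose l) * ln 2 ^ (N - l) *
          mzeta_at ((l + 2) # replicate j 1) (1/2)))"
    using integral_mult_harm_series(2)[OF f, of N] by (simp del: fact_Suc power_Suc)
qed

text \<open>Without a factor \<open>- ln (1 - u)\<close> the integral over \<open>(0, 1)\<close>
  diverges, so no difference of two integrals is available; an elementary antiderivative replaces it
  and gives the pure power of \<open>ln 2\<close>.\<close>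

lemma integral_neg_log_power_over_id:
  shows "(\<lambda>u::real. (- ln u) ^ N / u) absolutely_integrable_on {1/2<..<1::real}"
    and "integral {1/2<..<1} (\<lambda>u::real. (- ln u) ^ N / u) = ln 2 ^ Suc N / real (Suc N)"
proof -
  define F where "F u = - ((- ln u) ^ Suc N / real (Suc N))" for u :: real
  have "((\<lambda>u. (- ln u) ^ N / u) has_integral (F 1 - F (1/2))) {1/2..1}"
  proof (rule fundamental_theorem_of_calculus)
    fix u :: real assume u: "u \<in> {1/2..1}"
    have "DERIV F u :> (- ln u) ^ N / u"
      unfolding F_def using u
      by (auto intro!: derivative_eq_intros simp del: power_Suc)
    then show "(F has_vector_derivative (- ln u) ^ N / u) (at u within {1/2..1})"
      by (simp add: has_real_derivative_iff_has_vector_derivative[symmetric] has_field_derivative_at_within)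
  qed simp
  moreover have "F 1 - F (1/2) = ln 2 ^ Suc N / real (Suc N)"
    by (simp add: F_def ln_div)
  ultimately have I: "((\<lambda>u. (- ln u) ^ N / u) has_integral (ln 2 ^ Suc N / real (Suc N))) {1/2<..<1::real}"
    by (simp only: has_integral_Icc_iff_Ioo)
  then show "integral {1/2<..<1} (\<lambda>u::real. (- ln u) ^ N / u) = ln 2 ^ Suc N / real (Suc N)"
    by (rule integral_unique)
  show "(\<lambda>u::real. (- ln u) ^ N / u) absolutely_integrable_on {1/2<..<1::real}"
    using I by (intro nonnegative_absolutely_integrable_1) auto
qed

section \<open>The alternating sum as an integral\<close>

text \<open>The coefficients of \<open>ln (1 + x) ^ m / x\<close> supply one factor
  \<open>1 / (n + 1)\<close> and the moment over \<open>(0, 1)\<close> supplies \<open>k + 1\<close>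
  more, hence the exponent \<open>k + 2\<close>. The sign \<open>(-1) ^ m\<close> comes from the
  series at \<open>- x\<close>, and \<open>(-1) ^ k\<close> from writing \<open>ln x\<close> as
  \<open>- (- ln x)\<close>.\<close>

lemma mzeta_bar_eq_log_integral:
  "mzeta_bar {0} ((k + 2) # replicate j 1) =
     (-1) ^ (Suc j + k) / (fact (Suc j) * fact k) * log_integral k (Suc j)"
proof -
  define m where "m = Suc j"
  define c where "c n = (-1) ^ m * fact m * ((-1) ^ Suc n * (mult_harm j n / real (Suc n)))" for n
  define s where "s n = (-1) ^ Suc n * mult_harm j n / real (Suc n) ^ (k + 2)" for n
  have sm: "summable s"
  proof (rule summable_norm_cancel)
    have "norm (s n) = mult_harm j n / real (Suc n) ^ (k + 2)" for n
      using mult_harm_nonneg[of j n] by (simp add: s_def abs_mult)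
    then show "summable (\<lambda>n. norm (s n))"
      using summable_mult_harm[of "k + 2" j] by simp
  qed
  have bar: "mzeta_bar {0} ((k + 2) # replicate j 1) = suminf s"
    unfolding mzeta_bar_def s_def
    by (subst nested_series_ones[where d = "\<lambda>n. (-1) ^ n"]) (use sm in \<open>simp_all add: s_def[abs_def]\<close>)
  have f: "(\<lambda>n. c n * x ^ n) sums (ln (1 + x) ^ m / x)" if x: "0 < x" "x < 1" for x
  proof -
    have "(\<lambda>n. ((-1) ^ m * fact m / x) * (mult_harm j n / real (Suc n) * (- x) ^ Suc n)) sums
        (((-1) ^ m * fact m / x) * ((- ln (1 - - x)) ^ m / fact m))"
      unfolding m_def by (intro sums_mult log_power_sums) (use x in auto)
    moreover have "((-1) ^ m * fact m / x) * (mult_harm j n / real (Suc n) * (- x) ^ Suc n) = c n * x ^ n" for n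
      using x power_mult_distrib[of "-1" x "Suc n"] by (simp add: c_def)
    moreover have "((-1) ^ m * fact m / x) * ((- ln (1 - - x)) ^ m / fact m) = ln (1 + x) ^ m / x"
      using power_mult_distrib[of "-1" "- ln (1 + x)" m] by simp
    ultimately show ?thesis by (simp only:)
  qed
  have c1: "c n * log_moment n k 1 = (-1) ^ m * fact m * fact k * s n" for n
    unfolding log_moment_1 by (simp add: c_def s_def)
  have "\<bar>c n\<bar> * log_moment n k 1 = fact m * fact k * (mult_harm j n / real (Suc n) ^ (k + 2))" for n
    unfolding log_moment_1 using mult_harm_nonneg[of j n] by (simp add: c_def abs_mult)
  then have "summable (\<lambda>n. \<bar>c n\<bar> * log_moment n k 1)"
    by (simp only:) (intro summable_mult summable_mult_harm, simp)
  from integral_power_series_log(2)[OF _ _ f this]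
  have "integral {0<..<1} (\<lambda>x. ln (1 + x) ^ m / x * (- ln x) ^ k) = (-1) ^ m * fact m * fact k * suminf s"
    unfolding c1 using suminf_mult[OF sm] by simp
  moreover have "log_integral k m = (-1) ^ k * integral {0<..<1} (\<lambda>x. ln (1 + x) ^ m / x * (- ln x) ^ k)"
  proof -
    have L: "ln x ^ k = (-1) ^ k * (- ln x) ^ k" for x :: real
      by (simp flip: power_mult_distrib)
    have "(\<lambda>x::real. ln x ^ k * ln (1 + x) ^ m / x) = (\<lambda>x. (-1) ^ k * (ln (1 + x) ^ m / x * (- ln x) ^ k))"
      by (intro ext, subst L) simp
    then show ?thesis
      unfolding log_integral_def integral_open_interval_real
      by (simp only: Henstock_Kurzweil_Integration.integral_mult_right)
  qed
  ultimately have "log_integral k m = (-1) ^ (m + k) * (fact m * fact k) * suminf s"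
    by (simp add: power_add)
  then show ?thesis
    unfolding bar m_def[symmetric] by (simp add: field_simps flip: power_add power_mult_distrib)
qed

section \<open>Evaluation of the integral by substitution\<close>

lemma log_integral_substitution:
  assumes "m \<ge> 1"
  shows "log_integral k m = (\<Sum>j\<le>k. (-1) ^ j * real (k choose j) *
    (integral {1/2<..<1} (\<lambda>u. (- ln (1 - u)) ^ j / (1 - u) * (- ln u) ^ (k + m - j)) +
     integral {1/2<..<1} (\<lambda>u. (- ln (1 - u)) ^ j / u * (- ln u) ^ (k + m - j))))"
proof -
  define S where "S = {1/2<..<1::real}"
  define A where "A j u = (- ln (1 - u)) ^ j / (1 - u) * (- ln u) ^ (k + m - j)" for j and u :: real
  define B where "B j u = (- ln (1 - u)) ^ j / u * (- ln u) ^ (k + m - j)" for j and u :: real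
  define \<phi> where "\<phi> x = ln x ^ k * ln (1 + x) ^ m / x" for x :: real
  \<comment> \<open>The substitution \<open>u = 1 / (1 + x)\<close> solved for \<open>x\<close>. It
    is decreasing, so the absolute value of its derivative enters.\<close>
  define g where "g u = 1 / u - 1" for u :: real
  \<comment> \<open>Here \<open>j \<le> k\<close> and \<open>m \<ge> 1\<close> keep the exponent
    \<open>k + m - j\<close> positive.\<close>
  have A: "A j absolutely_integrable_on S" if "j \<in> {..k}" for j
    using integral_log_power_over_complement(1)[of "k + m - j" j] assms that
    by (simp add: A_def[abs_def] S_def)
  have B: "B j absolutely_integrable_on S" for j
    using integral_log_power_over_id(1)[of "j - 1" "k + m - j"] integral_neg_log_power_over_id(1)[of "k + m"]
    by (cases j) (simp_all add: B_def[abs_def] S_def del: power_Suc)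
  have AB: "(\<lambda>u. (-1) ^ j * real (k choose j) * (A j u + B j u)) absolutely_integrable_on S"
    if "j \<in> {..k}" for j
    using A[OF that] B[of j] by (intro set_integrable_mult_right set_integral_add)
  have image: "g ` S = {0<..<1}"
  proof (intro equalityI subsetI)
    fix x :: real assume x: "x \<in> {0<..<1}"
    then have "x = g (1 / (1 + x))" "1 / (1 + x) \<in> S"
      by (auto simp: g_def S_def field_simps)
    then show "x \<in> g ` S" by blast
  qed (auto simp: g_def S_def field_simps)
  have pointwise: "\<bar>- 1 / u\<^sup>2\<bar> * \<phi> (g u) = (\<Sum>j\<le>k. (-1) ^ j * real (k choose j) * (A j u + B j u))"
    if "u \<in> S" for u
  proof -
    have u: "0 < u" "u < 1" using that by (auto simp: S_def)
    define p q where "p = - ln (1 - u)" and "q = - ln u"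
    have "g u = (1 - u) / u"
      using u by (simp add: g_def field_simps)
    \<comment> \<open>Only \<open>p\<close> carries a minus sign, so the binomial expansion produces
      \<open>(-1) ^ j\<close>, which varies with \<open>j\<close>.\<close>
    then have 1: "ln (g u) = - p + q"
      using u by (simp add: p_def q_def ln_div)
    have 2: "ln (1 + g u) = q"
      using u by (simp add: g_def q_def ln_div)
    have 3: "\<bar>- 1 / u\<^sup>2\<bar> / g u = 1 / (1 - u) + 1 / u"
      using u by (simp add: g_def divide_simps power2_eq_square)
    have "\<bar>- 1 / u\<^sup>2\<bar> * \<phi> (g u) = (- p + q) ^ k * q ^ m * (\<bar>- 1 / u\<^sup>2\<bar> / g u)"
      by (simp add: \<phi>_def 1 2)
    also have "\<dots> = (\<Sum>j\<le>k. real (k choose j) * (- p) ^ j * q ^ (k - j) * q ^ m * (1 / (1 - u) + 1 / u))"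
      unfolding 3 binomial_ring[of "- p" q k] sum_distrib_right by simp
    also have "\<dots> = (\<Sum>j\<le>k. (-1) ^ j * real (k choose j) * (A j u + B j u))"
    proof (intro sum.cong refl)
      fix j assume "j \<in> {..k}"
      then have "q ^ (k - j) * q ^ m = q ^ (k + m - j)"
        by (simp flip: power_add)
      moreover have "(- p) ^ j = (-1) ^ j * p ^ j"
        by (simp flip: power_mult_distrib)
      ultimately have "real (k choose j) * (- p) ^ j * q ^ (k - j) * q ^ m * (1 / (1 - u) + 1 / u) =
          (-1) ^ j * real (k choose j) * (p ^ j * (1 / (1 - u) + 1 / u) * q ^ (k + m - j))"
        by (simp add: mult_ac)
      also have "p ^ j * (1 / (1 - u) + 1 / u) * q ^ (k + m - j) = A j u + B j u"
        by (simp add: A_def B_def p_def[symmetric] q_def[symmetric] algebra_simps)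
      finally show "real (k choose j) * (- p) ^ j * q ^ (k - j) * q ^ m * (1 / (1 - u) + 1 / u) =
          (-1) ^ j * real (k choose j) * (A j u + B j u)" .
    qed
    finally show ?thesis .
  qed
  have sum_abs: "(\<lambda>u. \<Sum>j\<le>k. (-1) ^ j * real (k choose j) * (A j u + B j u)) absolutely_integrable_on S"
    using AB by (intro absolutely_integrable_sum) auto
  have "(\<lambda>u. \<bar>- 1 / u\<^sup>2\<bar> * \<phi> (g u)) absolutely_integrable_on S"
    by (subst set_integrable_cong[OF refl refl pointwise]) (use sum_abs in auto)
  moreover have "\<And>u. u \<in> S \<Longrightarrow> (g has_field_derivative - 1 / u\<^sup>2) (at u within S)"
    unfolding g_def S_def
    by (auto intro!: derivative_eq_intros simp: power2_eq_square)
  moreover have "inj_on g S"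
    by (auto simp: inj_on_def g_def S_def)
  ultimately have "integral (g ` S) \<phi> = integral S (\<lambda>u. \<bar>- 1 / u\<^sup>2\<bar> * \<phi> (g u))"
    using has_absolute_integral_change_of_variables_1'[of S g "\<lambda>u. - 1 / u\<^sup>2" \<phi>]
    by (auto simp: S_def)
  also have "\<dots> = integral S (\<lambda>u. \<Sum>j\<le>k. (-1) ^ j * real (k choose j) * (A j u + B j u))"
    by (intro integral_cong pointwise)
  also have "\<dots> = (\<Sum>j\<le>k. integral S (\<lambda>u. (-1) ^ j * real (k choose j) * (A j u + B j u)))"
    using AB by (intro integral_sum) (auto intro: set_lebesgue_integral_eq_integral)
  also have "\<dots> = (\<Sum>j\<le>k. (-1) ^ j * real (k choose j) * (integral S (A j) + integral S (B j)))"
    using A B by (intro sum.cong refl)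
      (simp add: Henstock_Kurzweil_Integration.integral_add set_lebesgue_integral_eq_integral)
  also have "integral (g ` S) \<phi> = log_integral k m"
    unfolding image log_integral_def integral_open_interval_real by (simp add: \<phi>_def[abs_def])
  finally show ?thesis
    by (simp add: A_def[abs_def] B_def[abs_def] S_def)
qed

theorem theorem2p1:
  fixes k m :: nat
  assumes "m \<ge> 1"
  shows
    "mzeta_bar {0} ((k + 2) # replicate (m - 1) 1)
       = (-1) ^ (m + k) / (fact m * fact k) * log_integral k m
     \<and>
     log_integral k m =
         1 / real (m + k + 1) * ln 2 ^ (m + k + 1)
       + fact (m + k) * mzeta [m + k + 1]
       - (\<Sum>l = 0..m + k. fact l * real ((m + k) choose l) * ln 2 ^ (m + k - l) * Li (l + 1) (1 / 2))
       + (\<Sum>j = 1..k. (-1) ^ j * fact j * fact (k + m - j) * real (k choose j) *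
            (mzeta ((k + m + 2 - j) # replicate (j - 1) 1)
             + mzeta ((k + m + 1 - j) # replicate j 1)))
       - (\<Sum>j = 1..k. \<Sum>l = 0..k + m - j.
            (-1) ^ j * fact j * fact l * real (k choose j) * real ((k + m - j) choose l) *
            ln 2 ^ (m + k - j - l) *
            (mzeta_at ((l + 2) # replicate (j - 1) 1) (1 / 2)
             + mzeta_at ((l + 1) # replicate j 1) (1 / 2)))"
proof
  obtain i where i: "m = Suc i"
    using assms by (cases m) auto
  show "mzeta_bar {0} ((k + 2) # replicate (m - 1) 1)
       = (-1) ^ (m + k) / (fact m * fact k) * log_integral k m"
    using mzeta_bar_eq_log_integral[of k i] by (simp add: i)
  \<comment> \<open>Value of an integral over \<open>(1/2, 1)\<close> up to its factorial prefactor: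
    \<open>s = 1\<close> belongs to the pieces with \<open>1 / (1 - u)\<close>, \<open>s = 2\<close>
    to those with \<open>1 / u\<close>.\<close>
  define Z where "Z N s j = fact N * mzeta ((N + s) # replicate j 1) -
    (\<Sum>l\<le>N. fact l * real (N choose l) * ln 2 ^ (N - l) * mzeta_at ((l + s) # replicate j 1) (1/2))"
    for N s j
  define T where "T j = (-1) ^ j * real (k choose j) *
    (integral {1/2<..<1} (\<lambda>u. (- ln (1 - u)) ^ j / (1 - u) * (- ln u) ^ (k + m - j)) +
     integral {1/2<..<1} (\<lambda>u. (- ln (1 - u)) ^ j / u * (- ln u) ^ (k + m - j)))" for j
  \<comment> \<open>The summand \<open>j = 0\<close> stands apart because its \<open>1 / u\<close>
    piece is elementary; it yields the first three terms of the formula.\<close>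
  have "T 0 = Z (m + k) 1 0 + ln 2 ^ Suc (m + k) / real (Suc (m + k))"
    using integral_log_power_over_complement(2)[of "k + m" 0] integral_neg_log_power_over_id(2)[of "k + m"] assms
    by (simp add: T_def Z_def add.commute del: power_Suc of_nat_Suc)
  moreover have "Z (m + k) 1 0 = fact (m + k) * mzeta [m + k + 1] -
      (\<Sum>l = 0..m + k. fact l * real ((m + k) choose l) * ln 2 ^ (m + k - l) * Li (l + 1) (1 / 2))"
    by (simp add: Z_def mzeta_at_eq_Li atMost_atLeast0)
  moreover have "T j = (-1) ^ j * fact j * fact (k + m - j) * real (k choose j) *
            (mzeta ((k + m + 2 - j) # replicate (j - 1) 1)
             + mzeta ((k + m + 1 - j) # replicate j 1))
       - (\<Sum>l = 0..k + m - j.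
            (-1) ^ j * fact j * fact l * real (k choose j) * real ((k + m - j) choose l) *
            ln 2 ^ (m + k - j - l) *
            (mzeta_at ((l + 2) # replicate (j - 1) 1) (1 / 2)
             + mzeta_at ((l + 1) # replicate j 1) (1 / 2)))" if "j \<in> {1..k}" for j
  proof -
    obtain i where i: "j = Suc i"
      using \<open>j \<in> {1..k}\<close> by (cases j) auto
    have N: "k + m - j \<ge> 1" "k + m + 2 - j = (k + m - j) + 2" "k + m + 1 - j = (k + m - j) + 1"
        "m + k - j = k + m - j"
      using \<open>j \<in> {1..k}\<close> assms by auto
    \<comment> \<open>The \<open>1 / u\<close> piece comes from the primitive of the series with
      index \<open>i = j - 1\<close>, so its zeta values have one entry \<open>1\<close>
      fewer.\<close>
    have "T j = (-1) ^ j * real (k choose j) * fact j * (Z (k + m - j) 1 j + Z (k + m - j) 2 i)"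
      using integral_log_power_over_complement(2)[OF N(1), of j]
        integral_log_power_over_id(2)[of i "k + m - j", folded i]
      by (simp only: T_def Z_def distrib_left mult.assoc)
    also have "Z (k + m - j) 1 j + Z (k + m - j) 2 i = fact (k + m - j) *
        (mzeta ((k + m + 2 - j) # replicate i 1) + mzeta ((k + m + 1 - j) # replicate j 1)) -
        (\<Sum>l = 0..k + m - j. fact l * real ((k + m - j) choose l) * ln 2 ^ (k + m - j - l) *
          (mzeta_at ((l + 2) # replicate i 1) (1 / 2) + mzeta_at ((l + 1) # replicate j 1) (1 / 2)))"
      unfolding N Z_def by (simp add: algebra_simps sum.distrib atMost_atLeast0)
    finally show ?thesis
      unfolding right_diff_distrib sum_distrib_left N(4)
      by (simp add: i mult_ac del: fact_Suc power_Suc replicate_Suc)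
  qed
  moreover have "log_integral k m = T 0 + (\<Sum>j = 1..k. T j)"
    unfolding log_integral_substitution[OF assms] T_def[symmetric] atMost_atLeast0
    by (simp add: sum.atLeast_Suc_atMost)
  ultimately show "log_integral k m =
         1 / real (m + k + 1) * ln 2 ^ (m + k + 1)
       + fact (m + k) * mzeta [m + k + 1]
       - (\<Sum>l = 0..m + k. fact l * real ((m + k) choose l) * ln 2 ^ (m + k - l) * Li (l + 1) (1 / 2))
       + (\<Sum>j = 1..k. (-1) ^ j * fact j * fact (k + m - j) * real (k choose j) *
            (mzeta ((k + m + 2 - j) # replicate (j - 1) 1)
             + mzeta ((k + m + 1 - j) # replicate j 1)))
       - (\<Sum>j = 1..k. \<Sum>l = 0..k + m - j.
            (-1) ^ j * fact j * fact l * real (k choose j) * real ((k + m - j) choose l) *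
            ln 2 ^ (m + k - j - l) *
            (mzeta_at ((l + 2) # replicate (j - 1) 1) (1 / 2)
             + mzeta_at ((l + 1) # replicate j 1) (1 / 2)))"
    by (simp add: sum_subtractf)
qed

end
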